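(* Let $S\subseteq\mathbb{N}^p$ be a $\mathcal{C}$-semigroup, let $\tau_1,\ldots,\tau_t$ be the extremal rays of $\mathcal{C}_S$, and let $P$ be a (non-empty) ideal of $S$. Then $P\cup\{0\}$ is a $\mathcal{C}$-semigroup if and only if there exists a finite set $Y\subset P\setminus\{0\}$ such that $Y\cap\tau_i\neq\emptyset$ for all $i\in\{1,\ldots,t\}$.
   Context: $\mathbb{N}$ contains $0$, and $p\ge 1$. An affine semigroup $S\subseteq\mathbb{N}^p$ is a finitely generated submonoid of $(\mathbb{N}^p,+)$ (containing $0$). An ideal of $S$ is a non-empty subset $P\subseteq S$ with $P+S\subseteq P$. For $B\subseteq\mathbb{N}^p$, $\mathcal{C}_B=\{\sum_{i=1}^k\lambda_i b_i\mid k\in\mathbb{N},\ \lambda_i\in\mathbb{Q}_{\ge 0},\ b_i\in B\}\cap\mathbb{N}^p$ is the non-negative integer cone generated by $B$. A set $T\subseteq\mathbb{N}^p$ is called a $\mathcal{C}$-semigroup if $T$ is an affine semigroup and $\mathcal{C}_T\setminus T$ is finite. The extremal rays of $\mathcal{C}_S$ are the one-dimensional faces of the rational cone generated by $S$ (intersected with $\mathbb{N}^p$). *)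

theory Defs
  imports "HOL-Analysis.Analysis"
begin

text \<open>
  \<open>\<nat>\<^sup>p\<close> is rendered as \<^typ>\<open>nat ^ 'n\<close> with \<open>p = CARD('n) \<ge> 1\<close>; its ambient rational
  vector space is \<^typ>\<open>rat ^ 'n\<close> with scalar multiplication \<open>(*s)\<close>.
\<close>

definition add_submonoid :: "'a::comm_monoid_add set \<Rightarrow> bool" where
  "add_submonoid M \<longleftrightarrow> 0 \<in> M \<and> (\<forall>x\<in>M. \<forall>y\<in>M. x + y \<in> M)"

definition affine_semigroup :: "(nat ^ 'n) set \<Rightarrow> bool" where
  "affine_semigroup S \<longleftrightarrow> add_submonoid S \<and> (\<exists>A. finite A \<and> S = add_submonoid hull A)"

definition semigroup_ideal :: "'a::comm_monoid_add set \<Rightarrow> 'a set \<Rightarrow> bool" where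
  "semigroup_ideal S P \<longleftrightarrow> P \<noteq> {} \<and> P \<subseteq> S \<and> (\<forall>x\<in>P. \<forall>s\<in>S. x + s \<in> P)"

definition rat_vec :: "nat ^ 'n \<Rightarrow> rat ^ 'n" where
  "rat_vec x = (\<chi> i. of_nat (x $ i))"

definition rat_cone :: "(nat ^ 'n) set \<Rightarrow> (rat ^ 'n) set" where
  "rat_cone B = {(\<Sum>i<k. c i *s rat_vec (b i)) | (k::nat) c b. \<forall>i<k. 0 \<le> c i \<and> b i \<in> B}"

definition int_cone :: "(nat ^ 'n) set \<Rightarrow> (nat ^ 'n) set" where
  "int_cone B = {x. rat_vec x \<in> rat_cone B}"

definition C_semigroup :: "(nat ^ 'n) set \<Rightarrow> bool" where
  "C_semigroup T \<longleftrightarrow> affine_semigroup T \<and> finite (int_cone T - T)"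

text \<open>
  The library's \<^const>\<open>face_of\<close> is restricted to real vector spaces; this is the same
  definition over the rationals, with convexity and open segments written out.
\<close>

definition rat_face_of :: "(rat ^ 'n) set \<Rightarrow> (rat ^ 'n) set \<Rightarrow> bool" where
  "rat_face_of F K \<longleftrightarrow>
     F \<subseteq> K \<and>
     (\<forall>x\<in>F. \<forall>y\<in>F. \<forall>u. 0 \<le> u \<and> u \<le> 1 \<longrightarrow> (1 - u) *s x + u *s y \<in> F) \<and>
     (\<forall>x\<in>K. \<forall>y\<in>K. \<forall>u. 0 < u \<and> u < 1 \<and> (1 - u) *s x + u *s y \<in> F \<longrightarrow> x \<in> F \<and> y \<in> F)"

text \<open>
  A non-empty face of a cone contains \<open>0\<close>, so its dimension is that of its linear span.
  The extremal rays of \<open>int_cone S\<close> are sets of integer points, each containing \<open>0\<close>.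
\<close>

definition extremal_rays :: "(nat ^ 'n) set \<Rightarrow> (nat ^ 'n) set set" where
  "extremal_rays S =
     {{x. rat_vec x \<in> F} | F. rat_face_of F (rat_cone S) \<and> vec.dim F = 1}"

end

theory Submission imports Defs begin

text \<open>
  If \<open>P \<union> {0}\<close> is generated by a finite set \<open>A\<close>, take \<open>Y = A - {0}\<close>: for \<open>p \<in> P\<close> and a non-zero
  \<open>s \<in> S\<close> on an extremal ray, all \<open>p + n s\<close> lie in \<open>P\<close>, so Dickson's lemma applied to their
  coefficient vectors over \<open>A\<close> gives \<open>n < m\<close> for which \<open>(m - n) s\<close> is a non-negative integer combination of \<open>A\<close>;
  as the ray is a face, it contains a non-zero element of \<open>A\<close>.

  Conversely, a minimal set of generators of the cone of \<open>S\<close> lies on extremal rays, so \<open>Y\<close> spans the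
  same cone. Any integer point of that cone is either bounded by \<open>\<Sum>Y\<close> or of the form \<open>y + z\<close> with
  \<open>y \<in> Y\<close> and \<open>z\<close> again in the cone. Outside \<open>P\<close> the second case forces \<open>z \<notin> S\<close>, which leaves
  finitely many points; and descending along the same decomposition gives finite generation.
\<close>

section \<open>Rational cones\<close>

lemma rat_vec_0 [simp]: "rat_vec 0 = 0"
  by (simp add: rat_vec_def vec_eq_iff)

lemma rat_vec_add: "rat_vec (x + y) = rat_vec x + rat_vec y"
  by (simp add: rat_vec_def vec_eq_iff)

lemma rat_vec_scale: "rat_vec (k *s x) = of_nat k *s rat_vec x"
  by (simp add: rat_vec_def vec_eq_iff)

lemma rat_vec_sum: "rat_vec (sum f A) = (\<Sum>a\<in>A. rat_vec (f a))"
  by (induction A rule: infinite_finite_induct) (auto simp: rat_vec_add)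

lemma rat_vec_eq_iff [simp]: "rat_vec x = rat_vec y \<longleftrightarrow> x = y"
  by (simp add: rat_vec_def vec_eq_iff)

lemma rat_vec_eq_0_iff [simp]: "rat_vec x = 0 \<longleftrightarrow> x = 0"
  using rat_vec_eq_iff[of x 0] by (simp del: rat_vec_eq_iff)

lemma rat_cone_0: "0 \<in> rat_cone B"
  unfolding rat_cone_def by (rule CollectI, rule exI[of _ 0]) simp

lemma rat_cone_generator: "b \<in> B \<Longrightarrow> rat_vec b \<in> rat_cone B"
  unfolding rat_cone_def
  by (rule CollectI, rule exI[of _ 1], rule exI[of _ "\<lambda>_. 1"], rule exI[of _ "\<lambda>_. b"]) simp

lemma rat_cone_scale:
  assumes "x \<in> rat_cone B" "0 \<le> r" shows "r *s x \<in> rat_cone B"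
proof -
  obtain k :: nat and c b where x: "x = (\<Sum>i<k. c i *s rat_vec (b i))"
    and cb: "\<forall>i<k. 0 \<le> c i \<and> b i \<in> B"
    using assms unfolding rat_cone_def by blast
  have "r *s x = (\<Sum>i<k. (r * c i) *s rat_vec (b i))"
    unfolding x vec.scale_sum_right by (simp add: vector_smult_assoc)
  moreover have "\<forall>i<k. 0 \<le> r * c i \<and> b i \<in> B" using cb assms(2) by simp
  ultimately show ?thesis
    unfolding rat_cone_def
    by (intro CollectI exI[of _ k] exI[of _ "\<lambda>i. r * c i"] exI[of _ b]) blast
qed

lemma rat_cone_add:
  assumes "x \<in> rat_cone B" "y \<in> rat_cone B" shows "x + y \<in> rat_cone B"
proof -
  obtain k :: nat and c b where x: "x = (\<Sum>i<k. c i *s rat_vec (b i))"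
    and cb: "\<forall>i<k. 0 \<le> c i \<and> b i \<in> B"
    using assms unfolding rat_cone_def by blast
  obtain l :: nat and d e where y: "y = (\<Sum>i<l. d i *s rat_vec (e i))"
    and de: "\<forall>i<l. 0 \<le> d i \<and> e i \<in> B"
    using assms unfolding rat_cone_def by blast
  define c' where "c' i = (if i < k then c i else d (i - k))" for i
  define b' where "b' i = (if i < k then b i else e (i - k))" for i
  have "(\<Sum>i<k+l. c' i *s rat_vec (b' i))
      = (\<Sum>i<k. c' i *s rat_vec (b' i)) + (\<Sum>i<l. c' (k + i) *s rat_vec (b' (k + i)))"
    by (induction l) (auto simp: add.assoc)
  also have "\<dots> = x + y" unfolding x y c'_def b'_def by simp
  finally have "x + y = (\<Sum>i<k+l. c' i *s rat_vec (b' i))" by simp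
  moreover have "\<forall>i<k+l. 0 \<le> c' i \<and> b' i \<in> B"
    using cb de unfolding c'_def b'_def by auto
  ultimately show ?thesis
    unfolding rat_cone_def by blast
qed

lemma rat_cone_sum: "(\<And>i. i \<in> I \<Longrightarrow> f i \<in> rat_cone B) \<Longrightarrow> sum f I \<in> rat_cone B"
  by (induction I rule: infinite_finite_induct) (auto simp: rat_cone_0 rat_cone_add)

lemma rat_cone_least:
  assumes "\<And>b. b \<in> B \<Longrightarrow> rat_vec b \<in> rat_cone D"
  shows "rat_cone B \<subseteq> rat_cone D"
proof
  fix x assume "x \<in> rat_cone B"
  then obtain k :: nat and c b where x: "x = (\<Sum>i<k. c i *s rat_vec (b i))"
    and cb: "\<forall>i<k. 0 \<le> c i \<and> b i \<in> B"
    unfolding rat_cone_def by blast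
  show "x \<in> rat_cone D"
    unfolding x using cb by (auto intro!: rat_cone_sum rat_cone_scale assms)
qed

lemma rat_cone_mono: "B \<subseteq> D \<Longrightarrow> rat_cone B \<subseteq> rat_cone D"
  by (auto intro!: rat_cone_least rat_cone_generator)

lemma rat_cone_nonneg:
  assumes "x \<in> rat_cone B" shows "0 \<le> x $ i"
  using assms unfolding rat_cone_def
  by (auto simp: sum_component rat_vec_def intro!: sum_nonneg mult_nonneg_nonneg)

text \<open>Collecting the terms with the same generator gives one coefficient per element of
  \<open>B\<close>. Two points of the cone can then be compared coefficient by coefficient.\<close>

lemma rat_cone_finite:
  assumes "finite B" "x \<in> rat_cone B"
  obtains c where "\<And>b. 0 \<le> c b" "x = (\<Sum>b\<in>B. c b *s rat_vec b)"
proof -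
  obtain k :: nat and d e where x: "x = (\<Sum>i<k. d i *s rat_vec (e i))"
    and de: "\<forall>i<k. 0 \<le> d i \<and> e i \<in> B"
    using assms(2) unfolding rat_cone_def by blast
  define c where "c b = (\<Sum>i | i < k \<and> e i = b. d i)" for b
  have "x = (\<Sum>b\<in>B. \<Sum>i | i \<in> {..<k} \<and> e i = b. d i *s rat_vec (e i))"
    unfolding x using de assms(1) by (intro sum.group[symmetric]) auto
  also have "\<dots> = (\<Sum>b\<in>B. c b *s rat_vec b)"
    unfolding c_def vec.scale_sum_left by (intro sum.cong) auto
  finally have "x = (\<Sum>b\<in>B. c b *s rat_vec b)" .
  moreover have "0 \<le> c b" for b unfolding c_def using de by (auto intro: sum_nonneg)
  ultimately show ?thesis using that by blast
qed

text \<open>The cone is pointed: all coordinates of its elements are non-negative, so two of them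
  cancel only when both vanish.\<close>

lemma rat_cone_add_eq_0:
  assumes "x \<in> rat_cone B" "y \<in> rat_cone B" "x + y = 0"
  shows "x = 0" "y = 0"
proof -
  have "x $ i = 0 \<and> y $ i = 0" for i
  proof -
    have "x $ i + y $ i = 0" using assms(3) by (metis vector_add_component zero_index)
    then show ?thesis
      using rat_cone_nonneg[OF assms(1), of i] rat_cone_nonneg[OF assms(2), of i] by linarith
  qed
  then show "x = 0" "y = 0" by (simp_all add: vec_eq_iff)
qed

lemma rat_cone_sum_eq_0:
  assumes "finite I" "\<And>i. i \<in> I \<Longrightarrow> f i \<in> rat_cone B" "sum f I = 0" "j \<in> I"
  shows "f j = 0"
proof (rule rat_cone_add_eq_0(1))
  show "f j + sum f (I - {j}) = 0" using assms(3) sum.remove[OF assms(1,4), of f] by simp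
  show "f j \<in> rat_cone B" using assms(2,4) by blast
  show "sum f (I - {j}) \<in> rat_cone B" using assms(2) by (intro rat_cone_sum) blast
qed

section \<open>Faces and extremal rays\<close>

context
  fixes F :: "(rat ^ 'n) set" and B :: "(nat ^ 'n) set"
  assumes face: "rat_face_of F (rat_cone B)"
begin

lemma face_subset: "F \<subseteq> rat_cone B"
  using face unfolding rat_face_of_def by simp

lemma face_convex: "x \<in> F \<Longrightarrow> y \<in> F \<Longrightarrow> 0 \<le> u \<Longrightarrow> u \<le> 1 \<Longrightarrow> (1 - u) *s x + u *s y \<in> F"
  using face unfolding rat_face_of_def by simp

lemma face_split:
  assumes "(1 - u) *s x + u *s y \<in> F" "x \<in> rat_cone B" "y \<in> rat_cone B" "0 < u" "u < 1"
  shows "x \<in> F" "y \<in> F"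
  using face assms unfolding rat_face_of_def by blast+

text \<open>\<open>x\<close> is the midpoint of 0 and \<open>2 *s x\<close>, both in the cone, so
  the segment condition puts 0 into the face.\<close>

lemma face_0: assumes "x \<in> F" shows "0 \<in> F"
proof -
  have "(1 - 1/2) *s 0 + (1/2) *s (2 *s x) \<in> F"
    using assms by (simp add: vector_smult_assoc)
  then show ?thesis
    using face_split(1)[of "1/2" 0 "2 *s x"] assms face_subset rat_cone_0 rat_cone_scale[of x B 2]
    by auto
qed

lemma face_scale: assumes "x \<in> F" "0 \<le> c" shows "c *s x \<in> F"
proof (cases "c \<le> 1")
  case True
  then show ?thesis using face_convex[OF face_0[OF assms(1)] assms(1,2)] by simp
next
  case False
  \<comment> \<open>For \<open>c > 1\<close> convexity no longer suffices, but \<open>x\<close> lies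
    strictly between 0 and \<open>c *s x\<close>.\<close>
  have "(1 - 1/c) *s 0 + (1/c) *s (c *s x) \<in> F"
    using assms False by (simp add: vector_smult_assoc)
  then show ?thesis
    by (rule face_split(2))
      (use False assms face_subset in \<open>auto simp: rat_cone_0 intro!: rat_cone_scale\<close>)
qed

lemma face_unscale: assumes "c *s x \<in> F" "0 < c" shows "x \<in> F"
  using face_scale[OF assms(1), of "1/c"] assms(2) by (simp add: vector_smult_assoc)

text \<open>\<open>x + y\<close> is the midpoint of \<open>2 *s x\<close> and \<open>2 *s y\<close>,
  which turns the segment condition into closure under summands.\<close>

lemma face_summand:
  assumes "x + y \<in> F" "x \<in> rat_cone B" "y \<in> rat_cone B" shows "x \<in> F"
proof -
  have "(1 - 1/2) *s (2 *s x) + (1/2) *s (2 *s y) \<in> F"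
    using assms by (simp add: vector_smult_assoc)
  then have "2 *s x \<in> F"
    by (rule face_split(1)) (use assms in \<open>auto intro!: rat_cone_scale\<close>)
  then show ?thesis by (rule face_unscale) simp
qed

lemma face_sum:
  assumes "sum f I \<in> F" "finite I" "\<And>i. i \<in> I \<Longrightarrow> f i \<in> rat_cone B" "j \<in> I"
  shows "f j \<in> F"
  by (rule face_summand[of _ "sum f (I - {j})"])
    (use assms in \<open>auto simp: sum.remove[symmetric] intro!: rat_cone_sum\<close>)

text \<open>Some term of a non-zero sum is non-zero; as a summand it lies in the face, and dividing
  by its positive coefficient leaves the generator. This moves from rational points of a face to
  integer points on it.\<close>

lemma face_meets_generators:
  assumes "(\<Sum>i\<in>I. c i *s rat_vec (b i)) \<in> F" "(\<Sum>i\<in>I. c i *s rat_vec (b i)) \<noteq> 0"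
    and "finite I" "\<And>i. i \<in> I \<Longrightarrow> 0 \<le> c i \<and> b i \<in> B"
  obtains i where "i \<in> I" "b i \<noteq> 0" "rat_vec (b i) \<in> F"
proof -
  obtain i where i: "i \<in> I" "c i *s rat_vec (b i) \<noteq> 0"
    using assms(2) by (meson sum.neutral)
  have "c i *s rat_vec (b i) \<in> F"
    by (rule face_sum[OF assms(1,3) _ i(1)]) (use assms(4) in \<open>blast intro: rat_cone_scale rat_cone_generator\<close>)
  moreover have "0 < c i" "b i \<noteq> 0" using i assms(4)[of i] by (auto simp: less_le)
  ultimately show ?thesis using that[of i] face_unscale i by blast
qed

end

section \<open>Extremal rays from an irredundant generating set\<close>

text \<open>If a point of the ray is a proper convex combination of \<open>x\<close> and
  \<open>y\<close>, expanding both over \<open>B\<close> expresses a multiple of \<open>a\<close> by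
  all generators. Irredundancy of \<open>a\<close> and pointedness of the cone force every other
  coefficient to vanish, so \<open>x\<close> and \<open>y\<close> are multiples of
  \<open>a\<close>.\<close>

lemma rat_face_of_ray:
  assumes "finite B" "a \<in> B" "0 \<notin> B" "rat_vec a \<notin> rat_cone (B - {a})"
  shows "rat_face_of {r *s rat_vec a | r. 0 \<le> r} (rat_cone B)" (is "rat_face_of ?F _")
proof -
  have main: "x \<in> ?F \<and> y \<in> ?F"
    if xy: "x \<in> rat_cone B" "y \<in> rat_cone B" "0 < u" "u < 1" and F: "(1 - u) *s x + u *s y \<in> ?F"
    for x y u
  proof -
    obtain r where r: "(1 - u) *s x + u *s y = r *s rat_vec a" "0 \<le> r" using F by auto
    obtain c where c: "\<And>b. 0 \<le> c b" "x = (\<Sum>b\<in>B. c b *s rat_vec b)"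
      using rat_cone_finite[OF assms(1) xy(1)] by blast
    obtain d where d: "\<And>b. 0 \<le> d b" "y = (\<Sum>b\<in>B. d b *s rat_vec b)"
      using rat_cone_finite[OF assms(1) xy(2)] by blast
    define e where "e b = (1 - u) * c b + u * d b" for b
    have e0: "0 \<le> e b" for b unfolding e_def using c(1)[of b] d(1)[of b] xy by simp
    have "r *s rat_vec a = (\<Sum>b\<in>B. e b *s rat_vec b)"
      unfolding r(1)[symmetric] c(2) d(2) vec.scale_sum_right sum.distrib[symmetric] e_def
      by (intro sum.cong) (auto simp: vector_smult_assoc vec.scale_left_distrib)
    also have "\<dots> = e a *s rat_vec a + (\<Sum>b\<in>B - {a}. e b *s rat_vec b)"
      using assms by (simp add: sum.remove)
    finally have eq: "(r - e a) *s rat_vec a = (\<Sum>b\<in>B - {a}. e b *s rat_vec b)" (is "_ = ?R")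
      by (simp add: vec.scale_left_diff_distrib)
    have R: "?R \<in> rat_cone (B - {a})"
      using e0 by (auto intro!: rat_cone_sum rat_cone_scale rat_cone_generator)
    \<comment> \<open>Otherwise dividing by \<open>r - e a > 0\<close> would express
      \<open>a\<close> by the remaining generators.\<close>
    have "r \<le> e a"
    proof (rule ccontr)
      assume "\<not> r \<le> e a"
      then have "rat_vec a = (1 / (r - e a)) *s ?R"
        unfolding eq[symmetric] vector_smult_assoc by simp
      then show False using rat_cone_scale[OF R, of "1 / (r - e a)"] \<open>\<not> r \<le> e a\<close> assms(4) by simp
    qed
    \<comment> \<open>Both summands lie in the cone, so pointedness makes each of them zero.\<close>
    have "?R + (e a - r) *s rat_vec a = 0"
      unfolding eq[symmetric] by (simp add: vec.scale_left_diff_distrib)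
    moreover have "(e a - r) *s rat_vec a \<in> rat_cone B"
      using \<open>r \<le> e a\<close> assms(2) by (intro rat_cone_scale rat_cone_generator) simp_all
    moreover have "?R \<in> rat_cone B" using R rat_cone_mono[of "B - {a}" B] by blast
    ultimately have R0: "?R = 0" using rat_cone_add_eq_0 by blast
    have "e b *s rat_vec b = 0" if "b \<in> B - {a}" for b
    proof (rule rat_cone_sum_eq_0[of "B - {a}" "\<lambda>b. e b *s rat_vec b" B])
      show "e b *s rat_vec b \<in> rat_cone B" if "b \<in> B - {a}" for b
        using that e0 by (intro rat_cone_scale rat_cone_generator) auto
    qed (use that assms(1) R0 in auto)
    then have e: "e b = 0" if "b \<in> B - {a}" for b
      using that assms(3) by force
    \<comment> \<open>The weights \<open>1 - u\<close> and \<open>u\<close> are strictly positive,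
      so \<open>e b = 0\<close> kills both coefficients.\<close>
    have cd: "c b = 0 \<and> d b = 0" if "b \<in> B - {a}" for b
    proof -
      have "0 \<le> (1 - u) * c b" "0 \<le> u * d b" using c(1) d(1) xy by simp_all
      then have "(1 - u) * c b = 0" "u * d b = 0" using e[OF that] unfolding e_def by linarith+
      then show ?thesis using xy by simp
    qed
    have "x = c a *s rat_vec a" "y = d a *s rat_vec a"
      unfolding c(2) d(2) using cd assms(1,2) by (simp_all add: sum.remove)
    then show ?thesis using c(1) d(1) by blast
  qed
  have conv: "(1 - u) *s x + u *s y \<in> ?F" if xy: "x \<in> ?F" "y \<in> ?F" "0 \<le> u" "u \<le> 1" for x y u
  proof -
    obtain r q where rq: "x = r *s rat_vec a" "0 \<le> r" "y = q *s rat_vec a" "0 \<le> q"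
      using xy by blast
    have "(1 - u) *s x + u *s y = ((1 - u) * r + u * q) *s rat_vec a"
      unfolding rq by (simp add: vector_smult_assoc vec.scale_left_distrib)
    moreover have "0 \<le> (1 - u) * r + u * q" using rq xy by simp
    ultimately show ?thesis by blast
  qed
  have "?F \<subseteq> rat_cone B"
    using assms by (auto intro!: rat_cone_scale rat_cone_generator)
  then show ?thesis unfolding rat_face_of_def using main conv by blast
qed

lemma dim_ray:
  fixes v :: "rat ^ 'n"
  assumes "v \<noteq> 0" shows "vec.dim {r *s v | r. 0 \<le> r} = 1"
proof -
  have "v = 1 *s v" "(0::rat) \<le> 1" by simp_all
  then have "{v} \<subseteq> {r *s v | r. 0 \<le> r}" by blast
  moreover have "{r *s v | r. 0 \<le> r} \<subseteq> vec.span {v}"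
    by (auto simp: vec.span_singleton)
  ultimately show ?thesis
    using assms by (intro vec.dim_unique[of "{v}"]) auto
qed

text \<open>A generating subset of least cardinality is irredundant. It omits 0 because 0 lies in
  every cone.\<close>

lemma minimal_cone_generators:
  assumes "finite (A :: (nat ^ 'n) set)"
  obtains B where "B \<subseteq> A" "0 \<notin> B" "rat_cone B = rat_cone A"
    "\<And>a. a \<in> B \<Longrightarrow> rat_vec a \<notin> rat_cone (B - {a})"
proof -
  let ?P = "\<lambda>B. B \<subseteq> A \<and> rat_cone B = rat_cone A"
  have "?P A" by simp
  then obtain B where B: "?P B" and min: "\<And>D. ?P D \<Longrightarrow> card B \<le> card D"
    using exists_least_iff[of "\<lambda>n. \<exists>B. ?P B \<and> card B = n"] by (metis not_le)
  have fin: "finite B" using B assms finite_subset by blast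
  have irr: "rat_vec a \<notin> rat_cone (B - {a})" if "a \<in> B" for a
  proof
    assume "rat_vec a \<in> rat_cone (B - {a})"
    then have "rat_cone B \<subseteq> rat_cone (B - {a})"
      by (intro rat_cone_least) (metis Diff_iff rat_cone_generator singletonD)
    then have "?P (B - {a})" using B rat_cone_mono[of "B - {a}" B] by auto
    then show False using min[of "B - {a}"] that fin
      by (metis card_Diff1_less not_le)
  qed
  moreover have "0 \<notin> B"
    using irr[of 0] rat_cone_0 by auto
  ultimately show ?thesis using B that by blast
qed

text \<open>Each member of a minimal generating set spans an extremal ray. \<open>Y\<close> meets
  that ray in a non-zero point, of which the generator is a positive multiple.\<close>

lemma rat_cone_meeting_extremal_rays:
  assumes "finite A" "rat_cone S = rat_cone A" "0 \<notin> Y"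
    and "\<And>\<tau>. \<tau> \<in> extremal_rays S \<Longrightarrow> Y \<inter> \<tau> \<noteq> {}"
  shows "rat_cone S \<subseteq> rat_cone Y"
proof -
  obtain B where B: "B \<subseteq> A" "0 \<notin> B" "rat_cone B = rat_cone A"
    "\<And>a. a \<in> B \<Longrightarrow> rat_vec a \<notin> rat_cone (B - {a})"
    using minimal_cone_generators[OF assms(1)] by blast
  have fin: "finite B" using B(1) assms(1) finite_subset by blast
  have "rat_vec a \<in> rat_cone Y" if a: "a \<in> B" for a
  proof -
    let ?F = "{r *s rat_vec a | r. 0 \<le> r}"
    have "rat_face_of ?F (rat_cone S)"
      using rat_face_of_ray[OF fin a B(2) B(4)[OF a]] B(3) assms(2) by simp
    moreover have "vec.dim ?F = 1" using a B(2) by (intro dim_ray) auto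
    ultimately have "{x. rat_vec x \<in> ?F} \<in> extremal_rays S"
      unfolding extremal_rays_def by blast
    then obtain y r where y: "y \<in> Y" "rat_vec y = r *s rat_vec a" "0 \<le> r"
      using assms(4) by blast
    have "r \<noteq> 0" using y assms(3) by (metis rat_vec_eq_0_iff vec.scale_zero_left)
    then have "rat_vec a = (1 / r) *s rat_vec y" using y by (simp add: vector_smult_assoc)
    then show ?thesis using y by (metis rat_cone_scale rat_cone_generator zero_le_divide_1_iff)
  qed
  then show ?thesis using rat_cone_least[of B Y] B(3) assms(2) by simp
qed

section \<open>Generated submonoids\<close>

lemma add_submonoid_0: "add_submonoid M \<Longrightarrow> 0 \<in> M"
  and add_submonoid_add: "add_submonoid M \<Longrightarrow> x \<in> M \<Longrightarrow> y \<in> M \<Longrightarrow> x + y \<in> M"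
  unfolding add_submonoid_def by blast+

lemma add_submonoid_hull: "add_submonoid (add_submonoid hull A)"
  by (rule hull_in) (auto simp: add_submonoid_def)

text \<open>The combinations with natural coefficients form a submonoid containing \<open>A\<close>.
  The coefficient vectors are what Dickson's lemma is applied to.\<close>

lemma add_submonoid_hull_sum:
  fixes A :: "(nat ^ 'n) set"
  assumes "finite A" "x \<in> add_submonoid hull A"
  obtains k where "x = (\<Sum>a\<in>A. k a *s a)"
proof -
  let ?M = "{\<Sum>a\<in>A. k a *s a | k. True}"
  have "add_submonoid ?M"
    unfolding add_submonoid_def
  proof (intro conjI ballI)
    show "0 \<in> ?M" by (auto intro!: exI[of _ "\<lambda>_. 0"] simp: vec_eq_iff)
    fix x y assume "x \<in> ?M" "y \<in> ?M"
    then obtain k l where "x = (\<Sum>a\<in>A. k a *s a)" "y = (\<Sum>a\<in>A. l a *s a)" by blast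
    then have "x + y = (\<Sum>a\<in>A. (k a + l a) *s a)"
      by (simp add: vector_sadd_rdistrib sum.distrib)
    then show "x + y \<in> ?M" by (intro CollectI exI[of _ "\<lambda>a. k a + l a"]) simp
  qed
  moreover have "A \<subseteq> ?M"
  proof
    fix b assume b: "b \<in> A"
    have "b = (\<Sum>a\<in>A. (if a = b then 1 else 0) *s a)"
    proof -
      have "(if a = b then 1 else 0) *s a = (if a = b then b else 0)" for a
        by (cases "a = b") (simp_all add: vec_eq_iff[of "_ *s _"])
      then show ?thesis using assms(1) b by simp
    qed
    then show "b \<in> ?M" by (intro CollectI exI[of _ "\<lambda>a. if a = b then 1 else 0"]) simp
  qed
  ultimately have "add_submonoid hull A \<subseteq> ?M" by (intro hull_minimal)
  then show ?thesis using assms(2) that by blast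
qed

lemma rat_cone_hull:
  assumes "finite A" shows "rat_cone (add_submonoid hull A) = rat_cone A"
proof
  show "rat_cone (add_submonoid hull A) \<subseteq> rat_cone A"
  proof (rule rat_cone_least)
    fix x assume "x \<in> add_submonoid hull A"
    then obtain k where x: "x = (\<Sum>a\<in>A. k a *s a)" by (rule add_submonoid_hull_sum[OF assms])
    show "rat_vec x \<in> rat_cone A"
      unfolding x rat_vec_sum rat_vec_scale
      by (intro rat_cone_sum rat_cone_scale rat_cone_generator) auto
  qed
  show "rat_cone A \<subseteq> rat_cone (add_submonoid hull A)"
    by (rule rat_cone_mono) (rule hull_subset)
qed

section \<open>Monotone subsequences and Dickson's lemma\<close>

lemma nat_sequence_incseq_subsequence:
  fixes f :: "nat \<Rightarrow> nat"
  obtains r where "strict_mono r" "incseq (f \<circ> r)"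
proof -
  obtain r where r: "strict_mono r" "monoseq (f \<circ> r)"
    using seq_monosub[of f] by (auto simp: o_def)
  show ?thesis
  proof (cases "incseq (f \<circ> r)")
    case True then show ?thesis using r that by blast
  next
    case False
    then have dec: "decseq (f \<circ> r)" using r(2) monoseq_iff by blast
    \<comment> \<open>A decreasing sequence of naturals is constant from the position of its minimum
      on; shifting by \<open>N\<close> makes it increasing as well.\<close>
    define N where "N = arg_min (f \<circ> r) (\<lambda>_. True)"
    have N: "(f \<circ> r) N \<le> (f \<circ> r) n" for n
      unfolding N_def by (rule arg_min_nat_le) simp
    have "strict_mono (\<lambda>n. r (n + N))" using r(1) by (simp add: strict_mono_def)
    moreover have "incseq (f \<circ> (\<lambda>n. r (n + N)))"
    proof (rule incseq_SucI)
      fix n show "(f \<circ> (\<lambda>n. r (n + N))) n \<le> (f \<circ> (\<lambda>n. r (n + N))) (Suc n)"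
        using decseqD[OF dec, of N "n + N"] N[of "Suc n + N"] by simp
    qed
    ultimately show ?thesis using that by blast
  qed
qed

text \<open>The coordinates are treated one at a time: passing to a further subsequence keeps the
  earlier coordinates increasing.\<close>

lemma Dickson_subsequence:
  fixes f :: "nat \<Rightarrow> 'a \<Rightarrow> nat"
  assumes "finite A"
  obtains r where "strict_mono r" "\<And>a. a \<in> A \<Longrightarrow> incseq (\<lambda>n. f (r n) a)"
proof -
  from assms have "\<exists>r. strict_mono r \<and> (\<forall>a\<in>A. incseq (\<lambda>n. f (r n) a))"
  proof (induction A)
    case empty
    show ?case using strict_mono_id by blast
  next
    case (insert b A)
    then obtain r where r: "strict_mono r" "\<forall>a\<in>A. incseq (\<lambda>n. f (r n) a)" by blast
    obtain q where q: "strict_mono q" "incseq ((\<lambda>n. f (r n) b) \<circ> q)"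
      using nat_sequence_incseq_subsequence by blast
    have "incseq (\<lambda>n. f (r (q n)) a)" if "a \<in> A" for a
      using r(2) q(1) that by (auto simp: incseq_def strict_mono_less_eq)
    then show ?case
      using strict_mono_o[OF r(1) q(1)] q(2) by (intro exI[of _ "r \<circ> q"]) (auto simp: o_def)
  qed
  then show ?thesis using that by blast
qed

section \<open>Ideals and finite generation\<close>

text \<open>The forward direction: a finite generating set of \<open>P \<union> {0}\<close> already
  supplies a suitable \<open>Y\<close>.\<close>

lemma extremal_ray_meets_generators:
  fixes S P :: "(nat ^ 'n) set"
  assumes "add_submonoid S" "semigroup_ideal S P"
    and "finite A" "P \<union> {0} = add_submonoid hull A" "\<tau> \<in> extremal_rays S"
  shows "(A - {0}) \<inter> \<tau> \<noteq> {}"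
proof -
  have "A \<subseteq> P \<union> {0}" unfolding assms(4) by (rule hull_subset)
  then have AS: "A \<subseteq> S"
    using assms(1,2) by (auto simp: semigroup_ideal_def add_submonoid_def)
  obtain F where F: "rat_face_of F (rat_cone S)" "vec.dim F = 1" "\<tau> = {x. rat_vec x \<in> F}"
    using assms(5) unfolding extremal_rays_def by blast
  have "\<not> F \<subseteq> {0}" using F(2) vec.dim_eq_0[of F] by simp
  then obtain x where x: "x \<in> F" "x \<noteq> 0" by blast
  then have "x \<in> rat_cone S" using face_subset[OF F(1)] by blast
  then obtain k :: nat and c b where "x = (\<Sum>i<k. c i *s rat_vec (b i))"
    "\<forall>i<k. 0 \<le> c i \<and> b i \<in> S"
    unfolding rat_cone_def by blast
  \<comment> \<open>\<open>x\<close> is only a rational point of the ray; its expansion over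
    \<open>S\<close> yields an element of \<open>S\<close> on the same ray.\<close>
  with x obtain s where s: "s \<in> S" "s \<noteq> 0" "rat_vec s \<in> F"
    using face_meets_generators[OF F(1), of c b "{..<k}"] by (metis finite_lessThan lessThan_iff)
  obtain p where p: "p \<in> P" using assms(2) unfolding semigroup_ideal_def by blast
  have "p + n *s s \<in> P" for n
  proof (induction n)
    case 0 then show ?case using p by (simp add: vec_eq_iff)
  next
    case (Suc n)
    have "p + Suc n *s s = (p + n *s s) + s" by (simp add: vec_eq_iff)
    then show ?case using Suc s(1) assms(2) unfolding semigroup_ideal_def by metis
  qed
  then have "\<exists>k. p + n *s s = (\<Sum>a\<in>A. k a *s a)" for n
    using add_submonoid_hull_sum[OF assms(3)] assms(4) by (metis UnI1)
  then obtain k where k: "\<And>n. p + n *s s = (\<Sum>a\<in>A. k n a *s a)" by metis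
  obtain r where r: "strict_mono r" "\<And>a. a \<in> A \<Longrightarrow> incseq (\<lambda>n. k (r n) a)"
    using Dickson_subsequence[OF assms(3), of k] by blast
  \<comment> \<open>Two indices along the subsequence suffice: the coefficients of
    \<open>p + n *s s\<close> are bounded by those of \<open>p + m *s s\<close>.\<close>
  define m n where "m = r 1" and "n = r 0"
  have mn: "n < m" unfolding m_def n_def using r(1) by (simp add: strict_mono_def)
  have le: "k n a \<le> k m a" if "a \<in> A" for a
    unfolding m_def n_def using r(2)[OF that] by (simp add: incseq_def)
  \<comment> \<open>The difference is taken over the rationals, so \<open>p\<close> cancels exactly
    and no truncated subtraction occurs.\<close>
  define d where "d a = of_nat (k m a) - (of_nat (k n a) :: rat)" for a
  have kq: "rat_vec p + of_nat i *s rat_vec s = (\<Sum>a\<in>A. of_nat (k i a) *s rat_vec a)" for i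
    using arg_cong[OF k[of i], of rat_vec] by (simp add: rat_vec_add rat_vec_scale rat_vec_sum)
  have "(of_nat m - of_nat n) *s rat_vec s
      = (rat_vec p + of_nat m *s rat_vec s) - (rat_vec p + of_nat n *s rat_vec s)"
    by (simp add: vec.scale_left_diff_distrib)
  also have "\<dots> = (\<Sum>a\<in>A. d a *s rat_vec a)"
    unfolding kq d_def by (simp add: vec.scale_left_diff_distrib sum_subtractf)
  finally have eq: "(of_nat m - of_nat n) *s rat_vec s = (\<Sum>a\<in>A. d a *s rat_vec a)" .
  have "(of_nat m - of_nat n) *s rat_vec s \<in> F"
    using mn by (intro face_scale[OF F(1) s(3)]) simp
  moreover have "(of_nat m - of_nat n) *s rat_vec s \<noteq> 0"
    using mn s(2) by simp
  moreover have "0 \<le> d a \<and> a \<in> S" if "a \<in> A" for a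
    using le[OF that] that AS unfolding d_def by auto
  ultimately obtain a where "a \<in> A" "a \<noteq> 0" "rat_vec a \<in> F"
    using face_meets_generators[OF F(1), of d "\<lambda>a. a" A] assms(3) unfolding eq by metis
  then show ?thesis unfolding F(3) by blast
qed

section \<open>Removing generators from integer points of the cone\<close>

text \<open>If all coefficients of \<open>x\<close> over \<open>Y\<close> are below 1, then
  \<open>x\<close> is bounded by the sum of \<open>Y\<close>; otherwise a generator with coefficient
  at least 1 can be subtracted once without leaving the cone.\<close>

lemma int_cone_remove_generator:
  assumes "finite Y" "x \<in> int_cone Y"
  obtains "\<And>i. x $ i \<le> (\<Sum>Y) $ i" | y z where "y \<in> Y" "z \<in> int_cone Y" "x = y + z"
proof -
  obtain c where c: "\<And>b. 0 \<le> c b" "rat_vec x = (\<Sum>b\<in>Y. c b *s rat_vec b)"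
    using rat_cone_finite[OF assms(1), of "rat_vec x"] assms(2) unfolding int_cone_def by blast
  show ?thesis
  proof (cases "\<exists>y\<in>Y. 1 \<le> c y")
    case False
    have "x $ i \<le> (\<Sum>Y) $ i" for i
    proof -
      have "of_nat (x $ i) = rat_vec x $ i" by (simp add: rat_vec_def)
      also have "\<dots> = (\<Sum>b\<in>Y. c b * of_nat (b $ i))"
        unfolding c(2) by (simp add: rat_vec_def sum_component)
      also have "\<dots> \<le> (\<Sum>b\<in>Y. of_nat (b $ i))"
        using False by (intro sum_mono) (auto intro!: mult_left_le_one_le c(1) simp: not_le less_imp_le)
      also have "\<dots> = of_nat ((\<Sum>Y) $ i)" by (simp add: sum_component)
      finally show ?thesis by (simp only: of_nat_le_iff)
    qed
    then show ?thesis using that(1) by blast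
  next
    case True
    then obtain y where y: "y \<in> Y" "1 \<le> c y" by blast
    define w where "w = (c y - 1) *s rat_vec y + (\<Sum>b\<in>Y - {y}. c b *s rat_vec b)"
    have w: "w \<in> rat_cone Y"
      unfolding w_def using y c(1)
      by (intro rat_cone_add rat_cone_sum rat_cone_scale rat_cone_generator) auto
    have xw: "rat_vec x = rat_vec y + w"
      unfolding c(2) w_def using assms(1) y(1)
      by (simp add: sum.remove vec.scale_left_diff_distrib)
    \<comment> \<open>The remainder \<open>w\<close> has non-negative coordinates, so the
      subtraction in the naturals is exact and \<open>w\<close> comes from an integer point.\<close>
    have "y $ i \<le> x $ i" for i
    proof -
      have "of_nat (x $ i) = of_nat (y $ i) + w $ i"
        using arg_cong[OF xw, of "\<lambda>v. v $ i"] by (simp add: rat_vec_def)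
      then show ?thesis using rat_cone_nonneg[OF w, of i] by (simp flip: of_nat_le_iff[where 'a = rat])
    qed
    then have x: "x = y + (\<chi> i. x $ i - y $ i)" by (simp add: vec_eq_iff)
    then have "rat_vec (\<chi> i. x $ i - y $ i) = w"
      using xw rat_vec_add by (metis add_left_cancel)
    then show ?thesis using that(2)[OF y(1) _ x] w unfolding int_cone_def by simp
  qed
qed

lemma finite_bounded_nat_vec: "finite {x :: nat ^ 'n. \<forall>i. x $ i \<le> b i}"
proof -
  have "finite (PiE UNIV (\<lambda>i. {..b i}))" by (intro finite_PiE) auto
  then have "finite (vec_lambda ` PiE UNIV (\<lambda>i. {..b i}) :: (nat ^ 'n) set)" by simp
  moreover have "{x. \<forall>i. x $ i \<le> b i} \<subseteq> vec_lambda ` PiE UNIV (\<lambda>i. {..b i})"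
  proof
    fix x :: "nat ^ 'n" assume "x \<in> {x. \<forall>i. x $ i \<le> b i}"
    then show "x \<in> vec_lambda ` PiE UNIV (\<lambda>i. {..b i})"
      by (intro image_eqI[of _ _ "vec_nth x"]) auto
  qed
  ultimately show ?thesis using finite_subset by blast
qed

text \<open>A point \<open>y + z\<close> outside \<open>P\<close> with \<open>y\<close> in
  \<open>P\<close> has \<open>z\<close> outside \<open>S\<close>, since \<open>P\<close> absorbs
  \<open>S\<close>. Only finitely many such \<open>z\<close> lie in the cone, and the points without
  such a decomposition are bounded.\<close>

lemma finite_int_cone_diff_ideal:
  assumes "semigroup_ideal S P" "finite (int_cone Y - S)" "finite Y" "Y \<subseteq> P"
  shows "finite (int_cone Y - P)"
proof (rule finite_subset)
  let ?E = "{x. \<forall>i. x $ i \<le> (\<Sum>Y) $ i} \<union> (\<Union>y\<in>Y. (\<lambda>z. y + z) ` (int_cone Y - S))"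
  show "finite ?E" using assms(2,3) finite_bounded_nat_vec by auto
  show "int_cone Y - P \<subseteq> ?E"
  proof
    fix x assume x: "x \<in> int_cone Y - P"
    then have "x \<in> int_cone Y" by blast
    then show "x \<in> ?E"
    proof (cases rule: int_cone_remove_generator[OF assms(3), consumes 1])
      case 1 then show ?thesis by blast
    next
      case (2 y z)
      then have "z \<notin> S" using x assms(1,4) unfolding semigroup_ideal_def by blast
      then show ?thesis using 2 by blast
    qed
  qed
qed

lemma finitely_generated_if_cofinite:
  fixes T :: "(nat ^ 'n) set"
  assumes "add_submonoid T" "finite Y" "Y \<subseteq> T" "0 \<notin> Y" "T \<subseteq> int_cone Y" "finite (int_cone Y - T)"
  shows "affine_semigroup T"
proof -
  let ?E = "{x. \<forall>i. x $ i \<le> (\<Sum>Y) $ i} \<union> (\<Union>y\<in>Y. (\<lambda>z. y + z) ` (int_cone Y - T))"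
  \<comment> \<open>Besides \<open>Y\<close>, the generators are the points of \<open>T\<close>
    where the descent may stop: those bounded by the sum of \<open>Y\<close>, and those with a
    remainder outside \<open>T\<close>.\<close>
  define A where "A = Y \<union> T \<inter> ?E"
  have "finite ?E" using assms(2,6) finite_bounded_nat_vec by auto
  then have fin: "finite A" unfolding A_def using assms(2) by blast
  have "A \<subseteq> T" unfolding A_def using assms(3) by blast
  then have "add_submonoid hull A \<subseteq> T" using assms(1) by (intro hull_minimal)
  moreover have "x \<in> add_submonoid hull A" if "x \<in> T" for x
    using that
  \<comment> \<open>The coordinate sum drops whenever a generator is removed, because 0 is not in
    \<open>Y\<close>.\<close>
  proof (induction "\<Sum>i\<in>UNIV. x $ i" arbitrary: x rule: less_induct)
    case less
    then have "x \<in> int_cone Y" using assms(5) by blast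
    then show ?case
    proof (cases rule: int_cone_remove_generator[OF assms(2), consumes 1])
      case 1
      then have "x \<in> A" using less.prems unfolding A_def by blast
      then show ?thesis by (rule hull_inc)
    next
      case (2 y z)
      show ?thesis
      proof (cases "z \<in> T")
        case False
        then have "x \<in> A" using less.prems 2 unfolding A_def by blast
        then show ?thesis by (rule hull_inc)
      next
        case True
        have "y \<noteq> 0" using 2 assms(4) by blast
        then have "0 < (\<Sum>i\<in>UNIV. y $ i)" by (auto simp: vec_eq_iff intro: sum_pos2 gr0I)
        then have "(\<Sum>i\<in>UNIV. z $ i) < (\<Sum>i\<in>UNIV. x $ i)"
          unfolding 2(3) by (simp add: sum.distrib)
        then have "z \<in> add_submonoid hull A" using less.hyps True by blast
        moreover have "y \<in> add_submonoid hull A" using 2 unfolding A_def by (auto intro: hull_inc)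
        ultimately show ?thesis
          unfolding 2(3) using add_submonoid_add[OF add_submonoid_hull] by blast
      qed
    qed
  qed
  ultimately show ?thesis unfolding affine_semigroup_def using assms(1) fin by blast
qed

theorem proposition6:
  fixes S P :: "(nat ^ 'n) set"
  assumes "C_semigroup S"
    and "semigroup_ideal S P"
  shows "C_semigroup (P \<union> {0}) \<longleftrightarrow>
    (\<exists>Y. finite Y \<and> Y \<subseteq> P - {0} \<and> (\<forall>\<tau>\<in>extremal_rays S. Y \<inter> \<tau> \<noteq> {}))"
proof
  obtain G where G: "finite G" "S = add_submonoid hull G"
    using assms(1) unfolding C_semigroup_def affine_semigroup_def by blast
  have S: "add_submonoid S" "finite (int_cone S - S)"
    using assms(1) unfolding C_semigroup_def affine_semigroup_def by blast+
  {
    assume "C_semigroup (P \<union> {0})"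
    then obtain A where A: "finite A" "P \<union> {0} = add_submonoid hull A"
      unfolding C_semigroup_def affine_semigroup_def by blast
    have "A \<subseteq> P \<union> {0}" unfolding A(2) by (rule hull_subset)
    then have "A - {0} \<subseteq> P - {0}" by blast
    then show "\<exists>Y. finite Y \<and> Y \<subseteq> P - {0} \<and> (\<forall>\<tau>\<in>extremal_rays S. Y \<inter> \<tau> \<noteq> {})"
      using extremal_ray_meets_generators[OF S(1) assms(2) A] A(1)
      by (intro exI[of _ "A - {0}"] conjI ballI) simp_all
  next
    assume "\<exists>Y. finite Y \<and> Y \<subseteq> P - {0} \<and> (\<forall>\<tau>\<in>extremal_rays S. Y \<inter> \<tau> \<noteq> {})"
    then obtain Y where Y: "finite Y" "Y \<subseteq> P - {0}" "\<forall>\<tau>\<in>extremal_rays S. Y \<inter> \<tau> \<noteq> {}"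
      by blast
    have PS: "P \<union> {0} \<subseteq> S"
      using assms(2) add_submonoid_0[OF S(1)] unfolding semigroup_ideal_def by blast
    have "rat_cone S \<subseteq> rat_cone Y"
    proof (rule rat_cone_meeting_extremal_rays[OF G(1)])
      show "rat_cone S = rat_cone G" unfolding G(2) by (rule rat_cone_hull[OF G(1)])
    next
      show "0 \<notin> Y" using Y(2) by blast
    next
      show "Y \<inter> \<tau> \<noteq> {}" if "\<tau> \<in> extremal_rays S" for \<tau> using Y(3) that by blast
    qed
    \<comment> \<open>Equality of the cones turns the finiteness of the gaps of \<open>S\<close>
      into a statement about \<open>int_cone Y\<close>.\<close>
    then have cone: "int_cone Y = int_cone S"
      using rat_cone_mono[of Y S] Y(2) PS unfolding int_cone_def by blast
    have T: "add_submonoid (P \<union> {0})"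
      using assms(2) unfolding add_submonoid_def semigroup_ideal_def by auto
    have fin: "finite (int_cone Y - (P \<union> {0}))"
      using finite_int_cone_diff_ideal[OF assms(2), of Y] Y S(2) cone
      by (auto intro: finite_subset[of _ "int_cone Y - P"])
    have "P \<union> {0} \<subseteq> int_cone Y"
      unfolding cone using PS by (auto simp: int_cone_def rat_cone_0 rat_cone_generator)
    then have "affine_semigroup (P \<union> {0})"
      using finitely_generated_if_cofinite[OF T Y(1) _ _ _ fin] Y(2) by blast
    \<comment> \<open>The cone of \<open>P \<union> {0}\<close> lies inside that of
      \<open>S\<close>, which \<open>Y\<close> already generates.\<close>
    moreover have "int_cone (P \<union> {0}) - (P \<union> {0}) \<subseteq> int_cone Y - (P \<union> {0})"
      unfolding cone using rat_cone_mono[OF PS] by (auto simp: int_cone_def)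
    ultimately show "C_semigroup (P \<union> {0})"
      unfolding C_semigroup_def using fin finite_subset by blast
  }
qed

end
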